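(* Let $F$ be a graph with $m=e(F)>0$ edges, and let $n$ be the number of non-isolated vertices of $F$. If $q\ge \binom{n}{2}/m$ is a real number, then for every $\rho\in[0,1]$ and every $\rho$-locally dense graphon $W$, $$t(F,W^{\circ q})\ge \rho^{q\,e(F)}.$$
   Context: Graphs are finite and loopless; parallel edges are allowed, and $e(F)=|E(F)|$ counts edges with multiplicity. A graphon is a symmetric measurable function $W:[0,1]^2\to[0,1]$. For real $q>0$, $W^{\circ q}(x,y)=W(x,y)^q$. For a graph $F$ and a bounded nonnegative symmetric measurable $K:[0,1]^2\to\mathbb{R}$, $$t(F,K)=\int_{[0,1]^{V(F)}}\prod_{ij\in E(F)}K(x_i,x_j)\prod_{i\in V(F)}dx_i,$$ with the product over edges taken with multiplicity. For $\rho\in[0,1]$, a graphon $W$ is $\rho$-locally dense if $\int_{S\times S}W(x,y)\,dx\,dy\ge\rho\,\lambda(S)^2$ for every measurable $S\subseteq[0,1]$, where $\lambda$ is Lebesgue measure. *)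

theory Defs
  imports "HOL-Analysis.Analysis" "HOL-Library.Multiset"
begin

record 'a multigraph =
  verts :: "'a set"
  edges :: "'a set multiset"

definition loopless_multigraph :: "'a multigraph \<Rightarrow> bool" where
  "loopless_multigraph F \<longleftrightarrow>
     finite (verts F) \<and> (\<forall>e. e \<in># edges F \<longrightarrow> e \<subseteq> verts F \<and> card e = 2)"

definition num_edges :: "'a multigraph \<Rightarrow> nat" where
  "num_edges F = size (edges F)"

definition non_isolated_verts :: "'a multigraph \<Rightarrow> 'a set" where
  "non_isolated_verts F = {v \<in> verts F. \<exists>e. e \<in># edges F \<and> v \<in> e}"

text \<open>The two-variable functions below live on the unit square; their values at
  points outside it are arbitrary and never used. Measurability is Lebesgue measurability.\<close>

definition graphon :: "(real \<Rightarrow> real \<Rightarrow> real) \<Rightarrow> bool" where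
  "graphon W \<longleftrightarrow>
     (\<lambda>(x, y). W x y) \<in> borel_measurable (lebesgue_on ({0..1} \<times> {0..1})) \<and>
     (\<forall>x\<in>{0..1}. \<forall>y\<in>{0..1}. W x y = W y x \<and> W x y \<in> {0..1})"

definition pointwise_power :: "(real \<Rightarrow> real \<Rightarrow> real) \<Rightarrow> real \<Rightarrow> real \<Rightarrow> real \<Rightarrow> real" where
  "pointwise_power W q = (\<lambda>x y. W x y powr q)"

definition locally_dense :: "real \<Rightarrow> (real \<Rightarrow> real \<Rightarrow> real) \<Rightarrow> bool" where
  "locally_dense \<rho> W \<longleftrightarrow>
     (\<forall>S. S \<in> sets lebesgue \<and> S \<subseteq> {0..1} \<longrightarrow>
        (LINT z:S \<times> S|lebesgue. (case z of (x, y) \<Rightarrow> W x y)) \<ge> \<rho> * (measure lebesgue S)\<^sup>2)"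

text \<open>The factor \<open>K(x\<^sub>i, x\<^sub>j)\<close> of an unordered edge \<open>{i, j}\<close>. It is independent of the
  order of the endpoints when \<open>K\<close> is symmetric; see \<open>edge_factor_insert\<close>.\<close>

definition edge_factor ::
    "(real \<Rightarrow> real \<Rightarrow> real) \<Rightarrow> ('a \<Rightarrow> real) \<Rightarrow> 'a set \<Rightarrow> real" where
  "edge_factor K x e = (THE c. \<exists>i j. e = {i, j} \<and> c = K (x i) (x j))"

lemma edge_factor_insert:
  assumes "K (x i) (x j) = K (x j) (x i)"
  shows "edge_factor K x {i, j} = K (x i) (x j)"
  unfolding edge_factor_def
  by (rule the_equality) (use assms in \<open>auto simp: doubleton_eq_iff\<close>)

text \<open>Completing the finite product of Lebesgue-Borel measures on \<open>[0,1]\<close> gives Lebesgue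
  measure on the cube. The completion is needed because \<open>(x\<^sub>i, x\<^sub>j) \<mapsto> K(x\<^sub>i, x\<^sub>j)\<close> is
  in general only Lebesgue measurable.\<close>

definition unit_cube :: "'a set \<Rightarrow> ('a \<Rightarrow> real) measure" where
  "unit_cube V = completion (Pi\<^sub>M V (\<lambda>_. restrict_space lborel {0..1}))"

definition hom_density :: "'a multigraph \<Rightarrow> (real \<Rightarrow> real \<Rightarrow> real) \<Rightarrow> real" where
  "hom_density F K = (LINT x|unit_cube (verts F). (\<Prod>e\<in>#edges F. edge_factor K x e))"

end

theory Submission
  imports Defs "HOL-Probability.Infinite_Product_Measure" "HOL-Combinatorics.Permutations"
begin

text \<open>Let \<open>n\<close> be the number of non-isolated vertices and \<open>C = (n choose 2)\<close>. Two facts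
combine.

First, a \<open>\<rho>\<close>-locally dense graphon satisfies \<open>t(K\<^sub>n, W) \<ge> \<rho>^C\<close>
(\<open>weighted_clique_lower_bound\<close>). This goes by induction on \<open>n\<close>: after one vertex
is fixed at \<open>y\<close>, the rest of the clique sees the weight \<open>W(y, -)\<close> on its vertices, so
the statement is proved for arbitrary vertex weights \<open>f\<close>, with
\<open>\<rho>^C (\<integral> f)^n\<close> on the right-hand side; convexity of \<open>t \<mapsto> t^(n-1)\<close>
handles the integration over \<open>y\<close>. The induction needs the density condition for weights
\<open>f\<close> instead of sets, which follows by testing it on a random set that contains each point
\<open>x\<close> with probability \<open>f(x)\<close> (\<open>weighted_density\<close>).

Second, place the \<open>m\<close> edges of \<open>F\<close> by a uniformly random permutation \<open>\<sigma>\<close> of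
the \<open>n\<close> vertices. Every pair is hit equally often, so the geometric mean over \<open>\<sigma>\<close>
of the products \<open>\<Prod> W(\<sigma> e)^q\<close> is the clique product to the power
\<open>s = q m / C\<close>. By the arithmetic-geometric mean inequality
(\<open>clique_powr_le_average_over_placements\<close>) and symmetry of the measure,
\<open>t(F, W^q) \<ge> \<integral> u^s\<close> where \<open>u\<close> is the clique product. Since
\<open>s \<ge> 1\<close>, convexity gives
\<open>\<integral> u^s \<ge> (\<integral> u)^s \<ge> \<rho>^(C s) = \<rho>^(q m)\<close>
(\<open>power_hom_density_lower_bound\<close>).

The graphon is only Lebesgue measurable, and \<open>t(F, -)\<close> is an integral for a completed
product measure; both arguments are carried out for a Borel version of the graphon, which has
the same homomorphism densities and the same integrals over measurable rectangles.\<close>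

section \<open>Tangents to convex powers\<close>

text \<open>Jensen's inequality enters only through tangent lines: a convex power lies above its tangent
at \<open>c\<close>, and integrating the tangent needs only the mean of the argument. Working with a
tangent at a prescribed point rather than at the mean avoids dividing by a total mass that
may vanish.\<close>

lemma power_above_tangent:
  fixes c g :: real
  assumes "0 \<le> c" "0 \<le> g"
  shows "c ^ k + real k * c ^ (k - 1) * (g - c) \<le> g ^ k"
proof (cases "c = 0")
  case True
  then show ?thesis
    using assms by (cases k; cases "k - 1") auto
next
  case False
  then have c: "0 < c" using assms by simp
  have "c ^ k * (1 + real k * (g / c - 1)) \<le> c ^ k * (1 + (g / c - 1)) ^ k"
    using assms c by (intro mult_left_mono Bernoulli_inequality) auto
  also have "\<dots> = g ^ k"
    using c by (simp add: power_divide)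
  also have "c ^ k * (1 + real k * (g / c - 1)) = c ^ k + real k * c ^ (k - 1) * (g - c)"
    using c by (cases k) (auto simp: field_simps)
  finally show ?thesis .
qed

lemma powr_above_tangent:
  fixes c u s :: real
  assumes "0 < c" "0 \<le> u" "1 \<le> s"
  shows "c powr s + s * c powr (s - 1) * (u - c) \<le> u powr s"
proof (cases "u = 0")
  case True
  have "c powr (s - 1) * c = c powr s"
    using assms by (simp add: powr_diff)
  then have "c powr s + s * c powr (s - 1) * (u - c) = (1 - s) * c powr s"
    using True by (simp add: algebra_simps)
  also have "\<dots> \<le> 0"
    using assms by (simp add: mult_nonpos_nonneg)
  finally show ?thesis
    using True by simp
next
  case False
  have "u powr s - c powr s \<ge> s * c powr (s - 1) * (u - c)"
  proof (rule convex_on_imp_above_tangent[OF powr_convex])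
    show "((\<lambda>x. x powr s) has_real_derivative s * c powr (s - 1)) (at c within {0<..})"
      using assms by (auto intro!: derivative_eq_intros)
  qed (use assms False in \<open>auto simp: interior_open\<close>)
  then show ?thesis by simp
qed

section \<open>Placing the edges on random pairs\<close>

definition pairs :: "'a set \<Rightarrow> 'a set set" where
  "pairs V = {e. e \<subseteq> V \<and> card e = 2}"

lemma finite_pairs: "finite V \<Longrightarrow> finite (pairs V)"
  by (simp add: pairs_def)

lemma card_pairs: "finite V \<Longrightarrow> card (pairs V) = card V choose 2"
  by (simp add: pairs_def n_subsets)

lemma choose_two_pos:
  assumes "finite V" "e \<in> pairs V"
  shows "0 < card V choose 2"
  using card_pairs[OF assms(1)] finite_pairs[OF assms(1)] assms(2)
  by (metis card_gt_0_iff empty_iff)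

lemma permutes_image_pairs:
  assumes "\<sigma> permutes V" "e \<in> pairs V"
  shows "\<sigma> ` e \<in> pairs V"
  using assms permutes_inj_on[OF assms(1), of e] permutes_image[OF assms(1)]
  by (auto simp: pairs_def card_image)

text \<open>A bijection from \<open>p\<close> to \<open>p'\<close> extends by any bijection between the complements,
which have equal size because \<open>V\<close> is finite.\<close>

lemma obtain_permutation_image_eq:
  assumes "finite V" "p \<subseteq> V" "p' \<subseteq> V" "card p = card p'"
  obtains \<tau> where "\<tau> permutes V" "\<tau> ` p = p'"
proof -
  have fin: "finite p" "finite p'"
    using assms finite_subset by auto
  obtain f where f: "bij_betw f p p'"
    using finite_same_card_bij[OF fin assms(4)] by auto
  have "card (V - p) = card (V - p')"
    using assms fin by (simp add: card_Diff_subset)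
  then obtain g where g: "bij_betw g (V - p) (V - p')"
    using finite_same_card_bij[of "V - p" "V - p'"] assms(1) by auto
  define \<tau> where "\<tau> x = (if x \<in> p then f x else if x \<in> V then g x else x)" for x
  have 1: "bij_betw \<tau> p p'"
    using f by (rule bij_betw_cong[THEN iffD1, rotated]) (simp add: \<tau>_def)
  have 2: "bij_betw \<tau> (V - p) (V - p')"
    using g by (rule bij_betw_cong[THEN iffD1, rotated]) (simp add: \<tau>_def)
  have "bij_betw \<tau> (p \<union> (V - p)) (p' \<union> (V - p'))"
    using 1 2 by (rule bij_betw_combine) auto
  then have "bij_betw \<tau> V V"
    using assms(2,3) by (simp add: Un_absorb1 Un_Diff_cancel)
  then have "\<tau> permutes V"
    using assms(2) by (intro bij_imp_permutes) (auto simp: \<tau>_def)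
  then show ?thesis
    using that 1 by (auto simp: bij_betw_def)
qed

text \<open>By transitivity, composing with a permutation that takes \<open>r\<close> to \<open>r'\<close> compares the
permutations taking \<open>e\<close> to \<open>r\<close> with those taking \<open>e\<close> to \<open>r'\<close>, so all
these classes have the same size. They partition the symmetric group.\<close>

lemma card_permutations_image_eq:
  assumes V: "finite V" and e: "e \<in> pairs V" and p: "p \<in> pairs V"
  shows "card {\<sigma>. \<sigma> permutes V \<and> \<sigma> ` e = p} * (card V choose 2) = fact (card V)"
proof -
  let ?S = "{\<sigma>. \<sigma> permutes V}"
  define A where "A p = {\<sigma>\<in>?S. \<sigma> ` e = p}" for p
  have finS: "finite ?S"
    by (rule finite_permutations[OF V])
  have finA: "finite (A r)" for r
    unfolding A_def using finS by simp
  have le: "card (A r) \<le> card (A r')" if r: "r \<in> pairs V" "r' \<in> pairs V" for r r'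
  proof -
    obtain \<tau> where \<tau>: "\<tau> permutes V" "\<tau> ` r = r'"
      using obtain_permutation_image_eq[OF V, of r r'] r by (auto simp: pairs_def)
    have "inj_on (\<lambda>\<sigma>. \<tau> \<circ> \<sigma>) (A r)"
      using permutes_inj[OF \<tau>(1)] by (auto simp: inj_on_def fun_eq_iff)
    moreover have "(\<lambda>\<sigma>. \<tau> \<circ> \<sigma>) ` A r \<subseteq> A r'"
      using \<tau> by (auto simp: A_def image_comp[symmetric] intro: permutes_compose)
    ultimately show ?thesis
      using card_inj_on_le finA by blast
  qed
  have "fact (card V) = card ?S"
    using card_permutations[OF refl V] by simp
  also have "\<dots> = (\<Sum>r\<in>pairs V. card (A r))"
    using sum.group[OF finS finite_pairs[OF V], of "\<lambda>\<sigma>. \<sigma> ` e" "\<lambda>_. 1::nat"]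
      permutes_image_pairs[OF _ e] by (simp add: A_def image_subset_iff)
  also have "\<dots> = (\<Sum>r\<in>pairs V. card (A p))"
    using le p by (intro sum.cong refl antisym) auto
  finally show ?thesis
    using V by (simp add: card_pairs A_def mult.commute)
qed

lemma prod_permutations_image:
  fixes w :: "'a set \<Rightarrow> 'b :: comm_semiring_1"
  assumes V: "finite V" and e: "e \<in> pairs V"
  shows "(\<Prod>\<sigma>\<in>{\<sigma>. \<sigma> permutes V}. w (\<sigma> ` e))
           = (\<Prod>p\<in>pairs V. w p) ^ (fact (card V) div (card V choose 2))"
proof -
  let ?S = "{\<sigma>. \<sigma> permutes V}"
  have "(\<Prod>\<sigma>\<in>?S. w (\<sigma> ` e)) = (\<Prod>p\<in>pairs V. \<Prod>\<sigma>\<in>{\<sigma>\<in>?S. \<sigma> ` e = p}. w (\<sigma> ` e))"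
    using permutes_image_pairs[OF _ e]
    by (intro prod.group[symmetric] finite_permutations finite_pairs V) auto
  also have "\<dots> = (\<Prod>p\<in>pairs V. w p ^ (fact (card V) div (card V choose 2)))"
  proof (rule prod.cong[OF refl])
    fix p assume p: "p \<in> pairs V"
    have "card {\<sigma>\<in>?S. \<sigma> ` e = p} * (card V choose 2) = fact (card V)"
      using card_permutations_image_eq[OF V e p] by simp
    then have "card {\<sigma>\<in>?S. \<sigma> ` e = p} = fact (card V) div (card V choose 2)"
      using choose_two_pos[OF V p] by (metis div_mult_self_is_m)
    then show "(\<Prod>\<sigma>\<in>{\<sigma>\<in>?S. \<sigma> ` e = p}. w (\<sigma> ` e)) = w p ^ (fact (card V) div (card V choose 2))"
      by simp
  qed
  finally show ?thesis
    by (simp add: prod_power_distrib)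
qed

lemma prod_mset_unit_interval:
  fixes h :: "'b \<Rightarrow> 'c :: linordered_idom"
  assumes "\<And>e. e \<in># E \<Longrightarrow> 0 \<le> h e" "\<And>e. e \<in># E \<Longrightarrow> h e \<le> 1"
  shows "0 \<le> (\<Prod>e\<in>#E. h e)" "(\<Prod>e\<in>#E. h e) \<le> 1"
proof -
  have "0 \<le> (\<Prod>e\<in>#E. h e) \<and> (\<Prod>e\<in>#E. h e) \<le> 1"
    using assms by (induction E) (auto intro!: mult_le_one)
  then show "0 \<le> (\<Prod>e\<in>#E. h e)" "(\<Prod>e\<in>#E. h e) \<le> 1"
    by auto
qed

lemma prod_prod_mset_swap:
  fixes h :: "'b \<Rightarrow> 'c \<Rightarrow> 'd :: comm_monoid_mult"
  shows "(\<Prod>s\<in>S. \<Prod>e\<in>#E. h s e) = (\<Prod>e\<in>#E. \<Prod>s\<in>S. h s e)"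
  by (induction E) (auto simp: prod.distrib)

text \<open>Arithmetic-geometric mean inequality over the placements \<open>\<sigma>(E)\<close> of the edge multiset.
In the product over all \<open>\<sigma>\<close> every pair occurs equally often, so the geometric mean is a
power of the clique product; counting factors gives the exponent.\<close>

lemma clique_powr_le_average_over_placements:
  fixes w :: "'a set \<Rightarrow> real" and q :: real
  assumes V: "finite V" and E: "\<And>e. e \<in># E \<Longrightarrow> e \<in> pairs V" "E \<noteq> {#}"
    and w: "\<And>p. p \<in> pairs V \<Longrightarrow> 0 \<le> w p"
  shows "(\<Prod>p\<in>pairs V. w p) powr (q * real (size E) / real (card V choose 2))
    \<le> (\<Sum>\<sigma>\<in>{\<sigma>. \<sigma> permutes V}. \<Prod>e\<in>#E. w (\<sigma> ` e) powr q) / fact (card V)"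
proof -
  let ?S = "{\<sigma>. \<sigma> permutes V}"
  let ?C = "card V choose 2"
  define c where "c = (fact (card V) div ?C :: nat)"
  define u where "u = (\<Prod>p\<in>pairs V. w p)"
  have u: "0 \<le> u"
    unfolding u_def using w by (simp add: prod_nonneg)
  obtain e where e: "e \<in># E"
    using E(2) by auto
  have C: "0 < ?C"
    by (rule choose_two_pos[OF V E(1)[OF e]])
  have cC: "c * ?C = fact (card V)"
    using card_permutations_image_eq[OF V E(1)[OF e] E(1)[OF e]] C
    unfolding c_def by (intro dvd_div_mult_self) (metis dvd_triv_right)
  have cardS: "card ?S = fact (card V)"
    using card_permutations[OF refl V] by simp
  have c: "0 < c"
    using cC by (cases "c = 0") auto
  have "(\<Prod>\<sigma>\<in>?S. \<Prod>e\<in>#E. w (\<sigma> ` e) powr q) = (\<Prod>e\<in>#E. (u powr q) ^ c)"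
    unfolding prod_prod_mset_swap
  proof (intro arg_cong[where f = prod_mset] image_mset_cong)
    fix e assume "e \<in># E"
    then show "(\<Prod>\<sigma>\<in>?S. w (\<sigma> ` e) powr q) = (u powr q) ^ c"
      using prod_permutations_image[OF V E(1), of e "\<lambda>p. w p powr q"] w
      by (simp add: prod_powr_distrib u_def c_def)
  qed
  also have "\<dots> = (u powr q) ^ (c * size E)"
    by (simp add: power_mult)
  finally have prod: "(\<Prod>\<sigma>\<in>?S. \<Prod>e\<in>#E. w (\<sigma> ` e) powr q) = (u powr q) ^ (c * size E)" .
  have "u powr (q * real (size E) / real ?C) = ((u powr q) ^ (c * size E)) powr (1 / fact (card V))"
  proof (cases "u = 0")
    case True
    then show ?thesis
      using c E(2) by (simp add: power_0_left)
  next
    case False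
    have "((u powr q) ^ (c * size E)) powr (1 / fact (card V))
          = u powr (q * real (c * size E) * (1 / fact (card V)))"
      using False u by (simp add: powr_powr flip: powr_realpow)
    also have "q * real (c * size E) * (1 / fact (card V)) = q * real (size E) / real ?C"
    proof -
      have "fact (card V) = real c * real ?C"
        using cC by (metis of_nat_fact of_nat_mult)
      then show ?thesis
        using c by simp
    qed
    finally show ?thesis ..
  qed
  also have "\<dots> = (\<Prod>\<sigma>\<in>?S. \<Prod>e\<in>#E. w (\<sigma> ` e) powr q) powr (1 / real (card ?S))"
    by (simp add: prod cardS)
  also have "\<dots> \<le> (\<Sum>\<sigma>\<in>?S. (\<Prod>e\<in>#E. w (\<sigma> ` e) powr q) / real (card ?S))"
  proof (intro arith_geom_mean finite_permutations V)
    show "?S \<noteq> {}"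
      using permutes_id[of V] by blast
    show "0 \<le> (\<Prod>e\<in>#E. w (\<sigma> ` e) powr q)" for \<sigma>
      by (induction E) auto
  qed
  finally show ?thesis
    by (simp add: u_def cardS sum_divide_distrib)
qed

section \<open>Integration over powers of a probability space\<close>

context prob_space
begin

lemma prob_space_cube: "prob_space (Pi\<^sub>M V (\<lambda>_. M))"
  by (intro prob_space_PiM prob_space_axioms)

lemma integrable_cube_bounded:
  fixes h :: "('i \<Rightarrow> 'a) \<Rightarrow> real"
  assumes "h \<in> borel_measurable (Pi\<^sub>M V (\<lambda>_. M))" "\<And>x. 0 \<le> h x" "\<And>x. h x \<le> 1"
  shows "integrable (Pi\<^sub>M V (\<lambda>_. M)) h"
proof -
  interpret V: prob_space "Pi\<^sub>M V (\<lambda>_. M)" by (rule prob_space_cube)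
  show ?thesis
    using assms by (intro V.integrable_const_bound[of _ 1]) auto
qed

text \<open>Fubini with the new coordinate \<open>a\<close> outermost, the order in which a vertex of a clique is
fixed before the others. The second part makes the inner integral usable as an integrand.\<close>

lemma integral_cube_insert:
  fixes h :: "('i \<Rightarrow> 'a) \<Rightarrow> real"
  assumes I: "finite I" "a \<notin> I" and h: "h \<in> borel_measurable (Pi\<^sub>M (insert a I) (\<lambda>_. M))"
    and bounds: "\<And>x. 0 \<le> h x" "\<And>x. h x \<le> 1"
  shows "(\<integral>x. h x \<partial>Pi\<^sub>M (insert a I) (\<lambda>_. M)) = (\<integral>y. \<integral>x. h (x(a := y)) \<partial>Pi\<^sub>M I (\<lambda>_. M) \<partial>M)"
    and "(\<lambda>y. \<integral>x. h (x(a := y)) \<partial>Pi\<^sub>M I (\<lambda>_. M)) \<in> borel_measurable M"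
proof -
  interpret I: prob_space "Pi\<^sub>M I (\<lambda>_. M)" by (rule prob_space_cube)
  interpret P: pair_prob_space "Pi\<^sub>M I (\<lambda>_. M)" M ..
  interpret cube: product_prob_space "\<lambda>_. M" UNIV by unfold_locales
  have meas: "(\<lambda>(x, y). h (x(a := y))) \<in> borel_measurable (Pi\<^sub>M I (\<lambda>_. M) \<Otimes>\<^sub>M M)"
    using measurable_compose[OF measurable_add_dim h] by (simp add: case_prod_beta)
  then have "integrable (Pi\<^sub>M I (\<lambda>_. M) \<Otimes>\<^sub>M M) (\<lambda>(x, y). h (x(a := y)))"
    using bounds by (intro P.integrable_const_bound[of _ 1]) auto
  then show "(\<integral>x. h x \<partial>Pi\<^sub>M (insert a I) (\<lambda>_. M)) = (\<integral>y. \<integral>x. h (x(a := y)) \<partial>Pi\<^sub>M I (\<lambda>_. M) \<partial>M)"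
    by (subst cube.product_integral_insert)
      (auto simp: assms P.Fubini_integral intro: integrable_cube_bounded)
  have "(\<lambda>(y, x). h (x(a := y))) \<in> borel_measurable (M \<Otimes>\<^sub>M Pi\<^sub>M I (\<lambda>_. M))"
    using measurable_compose[OF measurable_pair_swap' meas] by (simp add: case_prod_beta)
  then show "(\<lambda>y. \<integral>x. h (x(a := y)) \<partial>Pi\<^sub>M I (\<lambda>_. M)) \<in> borel_measurable M"
    by (rule I.borel_measurable_lebesgue_integral)
qed

text \<open>Coordinates on which the integrand does not depend integrate out; this disposes of isolated
vertices.\<close>

lemma integral_cube_restrict:
  fixes h :: "('i \<Rightarrow> 'a) \<Rightarrow> real"
  assumes V: "I \<subseteq> V" and h: "h \<in> borel_measurable (Pi\<^sub>M I (\<lambda>_. M))"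
    and restrict: "\<And>x. h (restrict x I) = h x"
  shows "(\<integral>x. h x \<partial>Pi\<^sub>M V (\<lambda>_. M)) = (\<integral>x. h x \<partial>Pi\<^sub>M I (\<lambda>_. M))"
proof -
  have "distr (Pi\<^sub>M V (\<lambda>_. M)) (Pi\<^sub>M I (\<lambda>_. M)) (\<lambda>x. restrict x I) = Pi\<^sub>M I (\<lambda>_. M)"
    using V by (intro distr_PiM_reindex[where f = "\<lambda>i. i"] prob_space_axioms) auto
  then have "(\<integral>x. h x \<partial>Pi\<^sub>M I (\<lambda>_. M))
      = (\<integral>x. h x \<partial>distr (Pi\<^sub>M V (\<lambda>_. M)) (Pi\<^sub>M I (\<lambda>_. M)) (\<lambda>x. restrict x I))"
    by (rule arg_cong[OF sym])
  also have "\<dots> = (\<integral>x. h (restrict x I) \<partial>Pi\<^sub>M V (\<lambda>_. M))"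
    using V by (intro integral_distr h measurable_restrict_subset)
  finally show ?thesis
    by (simp add: restrict)
qed

lemma integral_cube_permute:
  fixes h :: "('i \<Rightarrow> 'a) \<Rightarrow> real"
  assumes \<sigma>: "\<sigma> permutes V" and h: "h \<in> borel_measurable (Pi\<^sub>M V (\<lambda>_. M))"
    and restrict: "\<And>x. h (restrict x V) = h x"
  shows "(\<integral>x. h (x \<circ> \<sigma>) \<partial>Pi\<^sub>M V (\<lambda>_. M)) = (\<integral>x. h x \<partial>Pi\<^sub>M V (\<lambda>_. M))"
proof -
  have "distr (Pi\<^sub>M V (\<lambda>_. M)) (Pi\<^sub>M V (\<lambda>_. M)) (\<lambda>x. restrict (x \<circ> \<sigma>) V) = Pi\<^sub>M V (\<lambda>_. M)"
    unfolding comp_def using permutes_inj_on[OF \<sigma>] permutes_in_image[OF \<sigma>]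
    by (intro distr_PiM_reindex prob_space_axioms) auto
  then have "(\<integral>x. h x \<partial>Pi\<^sub>M V (\<lambda>_. M))
      = (\<integral>x. h x \<partial>distr (Pi\<^sub>M V (\<lambda>_. M)) (Pi\<^sub>M V (\<lambda>_. M)) (\<lambda>x. restrict (x \<circ> \<sigma>) V))"
    by (rule arg_cong[OF sym])
  also have "\<dots> = (\<integral>x. h (restrict (x \<circ> \<sigma>) V) \<partial>Pi\<^sub>M V (\<lambda>_. M))"
    using permutes_in_image[OF \<sigma>]
    by (intro integral_distr h measurable_restrict) (auto simp: comp_def)
  finally show ?thesis
    by (simp add: restrict)
qed

lemma integral_pair_times:
  fixes g h :: "'a \<Rightarrow> real"
  assumes [measurable]: "g \<in> borel_measurable M" "h \<in> borel_measurable M"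
    and g: "\<And>x. 0 \<le> g x" "\<And>x. g x \<le> 1" and h: "\<And>x. 0 \<le> h x" "\<And>x. h x \<le> 1"
  shows "(\<integral>z. g (fst z) * h (snd z) \<partial>(M \<Otimes>\<^sub>M M)) = (\<integral>x. g x \<partial>M) * (\<integral>x. h x \<partial>M)"
proof -
  interpret MM: pair_prob_space M M ..
  have "integrable (M \<Otimes>\<^sub>M M) (\<lambda>z. g (fst z) * h (snd z))"
    using g h by (intro MM.integrable_const_bound[of _ 1]) (auto intro!: mult_le_one)
  then show ?thesis
    by (subst MM.integral_fst'[symmetric]) simp_all
qed

text \<open>Independence of two coordinates serves twice: it makes the random thresholds of distinct
cells independent, and it turns null sets of the square into null sets of the cube.\<close>

lemma distr_cube_pair:
  assumes ij: "i \<in> V" "j \<in> V" "i \<noteq> j"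
  shows "distr (Pi\<^sub>M V (\<lambda>_. M)) (M \<Otimes>\<^sub>M M) (\<lambda>x. (x i, x j)) = M \<Otimes>\<^sub>M M"
proof (rule pair_measure_eqI[symmetric])
  interpret cube: product_prob_space "\<lambda>_. M" V by unfold_locales
  fix A B assume AB: "A \<in> sets M" "B \<in> sets M"
  define X where "X k = (if k = i then A else B)" for k
  have "emeasure (distr (Pi\<^sub>M V (\<lambda>_. M)) (M \<Otimes>\<^sub>M M) (\<lambda>x. (x i, x j))) (A \<times> B)
      = emeasure (Pi\<^sub>M V (\<lambda>_. M)) ((\<lambda>x. (x i, x j)) -` (A \<times> B) \<inter> space (Pi\<^sub>M V (\<lambda>_. M)))"
    using ij AB by (intro emeasure_distr measurable_Pair measurable_component_singleton pair_measureI)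
  also have "(\<lambda>x. (x i, x j)) -` (A \<times> B) \<inter> space (Pi\<^sub>M V (\<lambda>_. M))
      = prod_emb V (\<lambda>_. M) {i, j} (Pi\<^sub>E {i, j} X)"
    using ij by (auto simp: prod_emb_def space_PiM X_def PiE_iff)
  also have "emeasure (Pi\<^sub>M V (\<lambda>_. M)) \<dots> = (\<Prod>k\<in>{i, j}. emeasure M (X k))"
    using ij AB by (intro cube.emeasure_PiM_emb) (auto simp: X_def)
  also have "\<dots> = emeasure M A * emeasure M B"
    using ij by (simp add: X_def)
  finally show "emeasure M A * emeasure M B
      = emeasure (distr (Pi\<^sub>M V (\<lambda>_. M)) (M \<Otimes>\<^sub>M M) (\<lambda>x. (x i, x j))) (A \<times> B)" ..
qed (auto intro: sigma_finite_measure_axioms)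

end

section \<open>Clique densities of weighted locally dense kernels\<close>

text \<open>The bounds and the symmetry are required at all points, not just on the support of
\<open>M\<close>, which removes side conditions from every product of edge factors.\<close>

locale symmetric_kernel = prob_space M for M :: "real measure" +
  fixes K :: "real \<Rightarrow> real \<Rightarrow> real"
  assumes kernel_measurable [measurable]: "case_prod K \<in> borel_measurable (M \<Otimes>\<^sub>M M)"
    and kernel_sym: "K x y = K y x"
    and kernel_nonneg: "0 \<le> K x y"
    and kernel_le_1: "K x y \<le> 1"
begin

sublocale MM: pair_prob_space M M ..

lemma edge_factor_kernel: "edge_factor K x {i, j} = K (x i) (x j)"
  by (rule edge_factor_insert) (rule kernel_sym)

lemma pairs_E:
  assumes "e \<in> pairs V"
  obtains i j where "i \<in> V" "j \<in> V" "i \<noteq> j" "e = {i, j}"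
  using assms by (auto simp: pairs_def card_2_iff)

lemma edge_factor_kernel_bounds:
  assumes "e \<in> pairs V"
  shows "0 \<le> edge_factor K x e" "edge_factor K x e \<le> 1"
  using assms by (auto elim!: pairs_E simp: edge_factor_kernel kernel_nonneg kernel_le_1)

lemma edge_factor_measurable:
  assumes "e \<in> pairs V"
  shows "(\<lambda>x. edge_factor K x e) \<in> borel_measurable (Pi\<^sub>M V (\<lambda>_. M))"
proof -
  obtain i j where ij[simp]: "i \<in> V" "j \<in> V" and e: "e = {i, j}"
    using assms by (rule pairs_E)
  have "(\<lambda>x. case_prod K (x i, x j)) \<in> borel_measurable (Pi\<^sub>M V (\<lambda>_. M))"
    by (rule measurable_compose[OF _ kernel_measurable]) simp
  then show ?thesis
    by (simp add: e edge_factor_kernel)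
qed

text \<open>The vertex weight \<open>f\<close> makes the induction on the clique possible: fixing one vertex at
\<open>y\<close> replaces \<open>f\<close> by \<open>f \<cdot> K(y, -)\<close>, so that the neighbourhood of \<open>y\<close>
enters as a weight on the smaller clique.\<close>

definition weighted_clique :: "(real \<Rightarrow> real) \<Rightarrow> 'a set \<Rightarrow> ('a \<Rightarrow> real) \<Rightarrow> real" where
  "weighted_clique f I x = (\<Prod>i\<in>I. f (x i)) * (\<Prod>e\<in>pairs I. edge_factor K x e)"

lemma weighted_clique_measurable:
  assumes [measurable]: "f \<in> borel_measurable M"
  shows "weighted_clique f I \<in> borel_measurable (Pi\<^sub>M I (\<lambda>_. M))"
  unfolding weighted_clique_def
  by (intro borel_measurable_times borel_measurable_prod edge_factor_measurable) measurable

lemma weighted_clique_bounds: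
  assumes "\<And>x. 0 \<le> f x" "\<And>x. f x \<le> 1"
  shows "0 \<le> weighted_clique f I x" "weighted_clique f I x \<le> 1"
  unfolding weighted_clique_def using assms edge_factor_kernel_bounds
  by (auto intro!: mult_nonneg_nonneg mult_le_one prod_nonneg prod_le_1)

lemma pairs_empty: "pairs {} = {}"
  by (auto simp: pairs_def)

lemma pairs_insert:
  assumes "a \<notin> I"
  shows "pairs (insert a I) = pairs I \<union> (\<lambda>i. {a, i}) ` I"
  using assms by (auto simp: pairs_def card_2_iff doubleton_eq_iff)

lemma weighted_clique_insert:
  assumes "finite I" "a \<notin> I"
  shows "weighted_clique f (insert a I) (x(a := y)) = f y * weighted_clique (\<lambda>z. f z * K y z) I x"
proof -
  let ?x = "x(a := y)"
  have inj: "inj_on (\<lambda>i. {a, i}) I"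
    by (auto simp: inj_on_def doubleton_eq_iff)
  have disj: "pairs I \<inter> (\<lambda>i. {a, i}) ` I = {}"
    using assms by (auto simp: pairs_def)
  have old: "(\<Prod>e\<in>pairs I. edge_factor K ?x e) = (\<Prod>e\<in>pairs I. edge_factor K x e)"
    using assms by (intro prod.cong) (auto elim!: pairs_E simp: edge_factor_kernel)
  have new: "(\<Prod>i\<in>I. edge_factor K ?x {a, i}) = (\<Prod>i\<in>I. K y (x i))"
    using assms by (intro prod.cong) (auto simp: edge_factor_kernel)
  have vert: "(\<Prod>i\<in>I. f (?x i)) = (\<Prod>i\<in>I. f (x i))"
    using assms by (intro prod.cong) auto
  show ?thesis
    using assms unfolding weighted_clique_def pairs_insert[OF assms(2)]
    by (simp add: prod.union_disjoint finite_pairs disj prod.reindex[OF inj] old new vert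
        prod.distrib ac_simps del: fun_upd_apply) simp
qed

text \<open>Induction on the number of vertices. Write \<open>m = \<integral> f\<close>, \<open>k = |I|\<close> and
\<open>g(y) = \<integral> f(z) K(y,z) dz\<close>. Fixing the new vertex at \<open>y\<close> and applying the
induction hypothesis to the weight \<open>f \<cdot> K(y, -)\<close> leaves
\<open>\<integral> f(y) g(y)^k dy\<close>. Density says that the \<open>f\<close>-weighted mean of \<open>g\<close>
is at least \<open>c = \<rho> m\<close>, so the tangent to \<open>g^k\<close> at \<open>c\<close> gives
\<open>\<integral> f g^k \<ge> c^k m = \<rho>^k m^(k+1)\<close>. The exponents of \<open>\<rho>\<close> add up to
\<open>1 + 2 + \<dots> + k\<close>.\<close>

lemma weighted_clique_lower_bound:
  assumes dense: "\<And>f. f \<in> borel_measurable M \<Longrightarrow> (\<And>x. 0 \<le> f x) \<Longrightarrow> (\<And>x. f x \<le> 1) \<Longrightarrow>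
      \<rho> * (\<integral>x. f x \<partial>M)\<^sup>2 \<le> (\<integral>x. f x * (\<integral>y. f y * K x y \<partial>M) \<partial>M)"
    and \<rho>: "0 \<le> \<rho>" and I: "finite I"
    and f: "f \<in> borel_measurable M" "\<And>x. 0 \<le> f x" "\<And>x. f x \<le> 1"
  shows "\<rho> ^ (card I choose 2) * (\<integral>x. f x \<partial>M) ^ card I
    \<le> (\<integral>x. weighted_clique f I x \<partial>Pi\<^sub>M I (\<lambda>_. M))"
  using I f
proof (induction I arbitrary: f rule: finite_induct)
  case empty
  interpret V: prob_space "Pi\<^sub>M {} (\<lambda>_. M)" by (rule prob_space_cube)
  show ?case
    by (simp add: pairs_empty weighted_clique_def V.prob_space[simplified] numeral_2_eq_2)
next
  case (insert a I)
  note [measurable] = insert.prems(1)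
  define k where "k = card I"
  define m where "m = (\<integral>x. f x \<partial>M)"
  define c where "c = \<rho> * m"
  define g where "g y = (\<integral>z. f z * K y z \<partial>M)" for y
  define G where "G y = (\<integral>x. weighted_clique (\<lambda>z. f z * K y z) I x \<partial>Pi\<^sub>M I (\<lambda>_. M))" for y
  have [measurable]: "(\<lambda>z. K y z) \<in> borel_measurable M" if "y \<in> space M" for y
    using measurable_Pair2[OF kernel_measurable that] by simp
  have fK: "(\<lambda>z. f z * K y z) \<in> borel_measurable M" if "y \<in> space M" for y
    using that by measurable
  have fK_bounds: "0 \<le> f z * K y z" "f z * K y z \<le> 1" for y z
    using insert.prems kernel_nonneg kernel_le_1 by (auto intro: mult_le_one)
  have unit_integrable: "integrable M h"
    if "h \<in> borel_measurable M" "\<And>y. y \<in> space M \<Longrightarrow> 0 \<le> h y" "\<And>y. y \<in> space M \<Longrightarrow> h y \<le> 1" for h :: "real \<Rightarrow> real"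
    using that by (intro integrable_const_bound[of _ 1]) auto
  have unit_integral: "0 \<le> (\<integral>y. h y \<partial>M)" "(\<integral>y. h y \<partial>M) \<le> 1"
    if "h \<in> borel_measurable M" "\<And>y. y \<in> space M \<Longrightarrow> 0 \<le> h y" "\<And>y. y \<in> space M \<Longrightarrow> h y \<le> 1" for h :: "real \<Rightarrow> real"
  proof -
    show "0 \<le> (\<integral>y. h y \<partial>M)" using that by (intro integral_nonneg_AE) auto
    show "(\<integral>y. h y \<partial>M) \<le> 1"
      using that by (intro integral_le_const unit_integrable) auto
  qed
  have g_meas [measurable]: "g \<in> borel_measurable M"
    unfolding g_def by measurable
  have g: "0 \<le> g y" "g y \<le> 1" if "y \<in> space M" for y
    unfolding g_def using unit_integral[OF fK] fK_bounds that by auto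
  have m: "0 \<le> m"
    unfolding m_def using insert.prems by (intro unit_integral) auto
  have c: "0 \<le> c" using \<rho> m by (simp add: c_def)
  have slice: "(\<integral>x. weighted_clique f (insert a I) (x(a := y)) \<partial>Pi\<^sub>M I (\<lambda>_. M)) = f y * G y" for y
    using insert.hyps by (simp add: weighted_clique_insert G_def)
  have clique_bounds: "0 \<le> weighted_clique f (insert a I) x" "weighted_clique f (insert a I) x \<le> 1" for x
    using weighted_clique_bounds[of f] insert.prems by auto
  have fG_meas [measurable]: "(\<lambda>y. f y * G y) \<in> borel_measurable M"
    using integral_cube_insert(2)[OF insert.hyps weighted_clique_measurable[OF insert.prems(1)] clique_bounds]
    by (simp add: slice)
  have G: "0 \<le> G y" "G y \<le> 1" if "y \<in> space M" for y
  proof -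
    interpret V: prob_space "Pi\<^sub>M I (\<lambda>_. M)" by (rule prob_space_cube)
    have b: "0 \<le> weighted_clique (\<lambda>z. f z * K y z) I x" "weighted_clique (\<lambda>z. f z * K y z) I x \<le> 1" for x
      using weighted_clique_bounds[of "\<lambda>z. f z * K y z"] fK_bounds by auto
    have i: "integrable (Pi\<^sub>M I (\<lambda>_. M)) (weighted_clique (\<lambda>z. f z * K y z) I)"
      using b by (intro integrable_cube_bounded weighted_clique_measurable fK that)
    show "0 \<le> G y" unfolding G_def using b by (intro integral_nonneg_AE) auto
    show "G y \<le> 1" unfolding G_def using b i by (intro V.integral_le_const) auto
  qed
  have IH: "\<rho> ^ (k choose 2) * g y ^ k \<le> G y" if "y \<in> space M" for y
    unfolding k_def g_def G_def by (intro insert.IH fK fK_bounds that)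
  have int_fg: "integrable M (\<lambda>y. f y * g y)"
    using insert.prems g by (intro unit_integrable) (auto intro: mult_le_one)
  have int_f: "integrable M f"
    using insert.prems by (intro unit_integrable) auto
  have step: "f y * (\<rho> ^ (k choose 2) * (c ^ k + real k * c ^ (k - 1) * (g y - c))) \<le> f y * G y"
    if "y \<in> space M" for y
  proof (rule mult_left_mono)
    have "\<rho> ^ (k choose 2) * (c ^ k + real k * c ^ (k - 1) * (g y - c)) \<le> \<rho> ^ (k choose 2) * g y ^ k"
      using \<rho> c g(1)[OF that] by (intro mult_left_mono power_above_tangent) auto
    also note IH[OF that]
    finally show "\<rho> ^ (k choose 2) * (c ^ k + real k * c ^ (k - 1) * (g y - c)) \<le> G y" .
  qed (use insert.prems in auto)
  have dense_f: "c * m \<le> (\<integral>y. f y * g y \<partial>M)"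
    using dense[OF insert.prems] by (simp add: c_def m_def g_def power2_eq_square mult.assoc)
  have "\<rho> ^ (card (insert a I) choose 2) * m ^ card (insert a I) = \<rho> ^ (k choose 2) * (c ^ k * m)"
    using insert.hyps by (simp add: k_def c_def numeral_2_eq_2 power_add power_mult_distrib ac_simps)
  also have "\<dots> \<le> \<rho> ^ (k choose 2) * (c ^ k * m + real k * c ^ (k - 1) * ((\<integral>y. f y * g y \<partial>M) - c * m))"
    using \<rho> c dense_f by (intro mult_left_mono) auto
  also have "\<dots> = (\<integral>y. \<rho> ^ (k choose 2) * (c ^ k * f y + real k * c ^ (k - 1) * (f y * g y - c * f y)) \<partial>M)"
    using int_f int_fg by (simp add: m_def)
  also have "\<dots> = (\<integral>y. f y * (\<rho> ^ (k choose 2) * (c ^ k + real k * c ^ (k - 1) * (g y - c))) \<partial>M)"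
    by (simp add: algebra_simps)
  also have "\<dots> \<le> (\<integral>y. f y * G y \<partial>M)"
  proof (rule integral_mono)
    have "integrable M (\<lambda>y. \<rho> ^ (k choose 2) * (c ^ k * f y + real k * c ^ (k - 1) * (f y * g y - c * f y)))"
      using int_f int_fg by auto
    then show "integrable M (\<lambda>y. f y * (\<rho> ^ (k choose 2) * (c ^ k + real k * c ^ (k - 1) * (g y - c))))"
      by (simp add: algebra_simps)
    show "integrable M (\<lambda>y. f y * G y)"
      using insert.prems G by (intro unit_integrable fG_meas) (auto intro: mult_le_one)
  qed (rule step)
  also have "\<dots> = (\<integral>x. weighted_clique f (insert a I) x \<partial>Pi\<^sub>M (insert a I) (\<lambda>_. M))"
    using integral_cube_insert(1)[OF insert.hyps weighted_clique_measurable[OF insert.prems(1)] clique_bounds]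
    by (simp add: slice)
  finally show ?case
    by (simp add: m_def)
qed

lemma edge_factor_comp_permutation:
  assumes "e \<in> pairs V"
  shows "edge_factor K (x \<circ> \<sigma>) e = edge_factor K x (\<sigma> ` e)"
  using assms by (auto elim!: pairs_E simp: edge_factor_kernel)

lemma edge_factor_restrict:
  assumes "e \<in> pairs V"
  shows "edge_factor K (restrict x V) e = edge_factor K x e"
  using assms by (auto elim!: pairs_E simp: edge_factor_kernel)

lemma prod_edge_factor_powr_measurable:
  assumes "\<And>e. e \<in># E \<Longrightarrow> e \<in> pairs V"
  shows "(\<lambda>x. \<Prod>e\<in>#E. edge_factor K x e powr q) \<in> borel_measurable (Pi\<^sub>M V (\<lambda>_. M))"
proof -
  have [measurable]: "(\<lambda>x. edge_factor K x e powr q) \<in> borel_measurable (Pi\<^sub>M V (\<lambda>_. M))"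
    if "e \<in> pairs V" for e
    using edge_factor_measurable[OF that] by measurable
  show ?thesis
    using assms by (induction E) auto
qed

text \<open>Let \<open>u\<close> be the clique product on \<open>I\<close>, \<open>C = (|I| choose 2)\<close> and
\<open>s = q |E| / C\<close>. Relabelling the vertices preserves the measure, so every placement of
\<open>E\<close> has the same integral and the average over placements bounds
\<open>\<integral> u^s\<close> from above by the integral on the right. The hypothesis on \<open>q\<close> is
exactly \<open>s \<ge> 1\<close>, the condition for \<open>t \<mapsto> t^s\<close> to be convex; hence
\<open>\<integral> u \<ge> \<rho>^C\<close> gives \<open>\<integral> u^s \<ge> \<rho>^(C s) = \<rho>^(q |E|)\<close>.\<close>

lemma power_hom_density_lower_bound:
  assumes dense: "\<And>f. f \<in> borel_measurable M \<Longrightarrow> (\<And>x. 0 \<le> f x) \<Longrightarrow> (\<And>x. f x \<le> 1) \<Longrightarrow>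
      \<rho> * (\<integral>x. f x \<partial>M)\<^sup>2 \<le> (\<integral>x. f x * (\<integral>y. f y * K x y \<partial>M) \<partial>M)"
    and \<rho>: "0 \<le> \<rho>" and V: "finite V" "I \<subseteq> V"
    and E: "\<And>e. e \<in># E \<Longrightarrow> e \<in> pairs I" "E \<noteq> {#}"
    and q: "real (card I choose 2) / real (size E) \<le> q"
  shows "\<rho> powr (q * real (size E))
    \<le> (\<integral>x. (\<Prod>e\<in>#E. edge_factor K x e powr q) \<partial>Pi\<^sub>M V (\<lambda>_. M))"
\<comment> \<open>The tangent below needs \<open>\<rho> > 0\<close>; for \<open>\<rho> = 0\<close> the left-hand side is \<open>0 powr _ = 0\<close>.\<close>
proof (cases "\<rho> = 0")
  case True
  have "0 \<le> (\<Prod>e\<in>#E. edge_factor K x e powr q)" for x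
    by (induction E) auto
  then show ?thesis
    using True by (simp add: integral_nonneg_AE)
next
  case False
  let ?P = "Pi\<^sub>M I (\<lambda>_. M)"
  let ?S = "{\<sigma>. \<sigma> permutes I}"
  interpret P: prob_space ?P by (rule prob_space_cube)
  have I: "finite I" using V finite_subset by auto
  define C where "C = card I choose 2"
  define s where "s = q * real (size E) / real C"
  define c where "c = \<rho> ^ C"
  define h where "h x = (\<Prod>e\<in>#E. edge_factor K x e powr q)" for x
  define u where "u x = (\<Prod>e\<in>pairs I. edge_factor K x e)" for x
  obtain e where e: "e \<in># E" using E(2) by auto
  have C: "0 < C"
    unfolding C_def by (rule choose_two_pos[OF I E(1)[OF e]])
  have m: "0 < size E" using E(2) by (simp add: nonempty_has_size)
  have s: "1 \<le> s"
    using q C m by (simp add: s_def C_def field_simps)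
  have q0: "0 \<le> q"
    using q by (rule order_trans[rotated]) simp
  have c: "0 < c" using \<rho> False by (simp add: c_def)
  have h_bounds: "0 \<le> h x" "h x \<le> 1" for x
    unfolding h_def
    by (rule prod_mset_unit_interval; use edge_factor_kernel_bounds[OF E(1)] q0 in \<open>simp add: powr_le1\<close>)+
  have h_meas: "h \<in> borel_measurable ?P"
    unfolding h_def[abs_def] using E(1) by (rule prod_edge_factor_powr_measurable)
  have h_restrict: "h (restrict x I) = h x" for x
    unfolding h_def using E(1)
    by (intro arg_cong[where f = prod_mset] image_mset_cong) (simp add: edge_factor_restrict[of _ I])
  have h_perm_int: "integrable ?P (\<lambda>x. h (x \<circ> \<sigma>))" if \<sigma>: "\<sigma> permutes I" for \<sigma>
  proof (rule integrable_cube_bounded)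
    have "(\<lambda>x. h (restrict (x \<circ> \<sigma>) I)) \<in> borel_measurable ?P"
      using permutes_in_image[OF \<sigma>]
      by (intro measurable_compose[OF _ h_meas] measurable_restrict) (auto simp: comp_def)
    then show "(\<lambda>x. h (x \<circ> \<sigma>)) \<in> borel_measurable ?P"
      by (simp add: h_restrict)
  qed (rule h_bounds)+
  have u: "u = weighted_clique (\<lambda>_. 1) I"
    by (simp add: fun_eq_iff u_def weighted_clique_def)
  have u_bounds: "0 \<le> u x" "u x \<le> 1" for x
    unfolding u by (rule weighted_clique_bounds; simp)+
  have u_int: "integrable ?P u"
    by (intro integrable_cube_bounded u_bounds) (simp add: u weighted_clique_measurable)
  have "\<rho> ^ C * (\<integral>x. 1 \<partial>M) ^ card I \<le> (\<integral>x. weighted_clique (\<lambda>_. 1) I x \<partial>?P)"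
    unfolding C_def by (rule weighted_clique_lower_bound[OF _ \<rho> I]) (rule dense | simp)+
  then have "c \<le> (\<integral>x. u x \<partial>?P)"
    by (simp add: u c_def prob_space)
  moreover have "0 \<le> s * c powr (s - 1)"
    using s by simp
  ultimately have "c powr s \<le> c powr s + s * c powr (s - 1) * ((\<integral>x. u x \<partial>?P) - c)"
    by (simp add: mult_nonneg_nonneg)
  also have "\<dots> = (\<integral>x. c powr s + s * c powr (s - 1) * (u x - c) \<partial>?P)"
    using u_int by (simp add: P.prob_space)
  also have "\<dots> \<le> (\<integral>x. (\<Sum>\<sigma>\<in>?S. h (x \<circ> \<sigma>)) / fact (card I) \<partial>?P)"
  proof (rule integral_mono)
    fix x
    have "c powr s + s * c powr (s - 1) * (u x - c) \<le> u x powr s"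
      using c u_bounds(1) s by (rule powr_above_tangent)
    also have "\<dots> \<le> (\<Sum>\<sigma>\<in>?S. \<Prod>e\<in>#E. edge_factor K x (\<sigma> ` e) powr q) / fact (card I)"
      unfolding u_def s_def C_def
      by (rule clique_powr_le_average_over_placements[OF I E])
        (simp_all add: edge_factor_kernel_bounds)
    also have "\<dots> = (\<Sum>\<sigma>\<in>?S. h (x \<circ> \<sigma>)) / fact (card I)"
      unfolding h_def using E(1)
      by (intro arg_cong2[where f = "(/)"] sum.cong arg_cong[where f = prod_mset] image_mset_cong refl)
        (simp add: edge_factor_comp_permutation[of _ I])
    finally show "c powr s + s * c powr (s - 1) * (u x - c) \<le> (\<Sum>\<sigma>\<in>?S. h (x \<circ> \<sigma>)) / fact (card I)" .
  next
    show "integrable ?P (\<lambda>x. c powr s + s * c powr (s - 1) * (u x - c))"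
      using u_int by simp
    show "integrable ?P (\<lambda>x. (\<Sum>\<sigma>\<in>?S. h (x \<circ> \<sigma>)) / fact (card I))"
      using h_perm_int by (intro integrable_divide_zero Bochner_Integration.integrable_sum) simp_all
  qed
  also have "\<dots> = (\<Sum>\<sigma>\<in>?S. (\<integral>x. h (x \<circ> \<sigma>) \<partial>?P)) / fact (card I)"
    using h_perm_int by (simp add: Bochner_Integration.integral_sum)
  also have "\<dots> = (\<Sum>\<sigma>\<in>?S. (\<integral>x. h x \<partial>?P)) / fact (card I)"
    by (intro arg_cong2[where f = "(/)"] sum.cong refl) (auto intro: integral_cube_permute[OF _ h_meas h_restrict])
  also have "\<dots> = (\<integral>x. h x \<partial>?P)"
    using card_permutations[OF refl I] by simp
  also have "\<dots> = (\<integral>x. h x \<partial>Pi\<^sub>M V (\<lambda>_. M))"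
    by (rule integral_cube_restrict[symmetric, OF V(2) h_meas h_restrict])
  also have "c powr s = \<rho> powr (q * real (size E))"
  proof -
    have "c = \<rho> powr real C"
      using \<rho> False by (simp add: c_def powr_realpow)
    moreover have "real C * s = q * real (size E)"
      using C by (simp add: s_def)
    ultimately show ?thesis
      by (simp only: powr_powr)
  qed
  finally show ?thesis
    by (simp add: h_def)
qed

end

section \<open>From sets to weights on the unit interval\<close>

definition uniform01 :: "real measure" where
  "uniform01 = restrict_space lborel {0..1}"

lemma space_uniform01 [simp]: "space uniform01 = {0..1}"
  by (simp add: uniform01_def space_restrict_space)

lemma sets_uniform01: "S \<in> sets uniform01 \<longleftrightarrow> S \<in> sets borel \<and> S \<subseteq> {0..1}"
  by (auto simp: uniform01_def sets_restrict_space_iff)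

lemma borel_measurable_uniform01:
  "h \<in> borel_measurable borel \<Longrightarrow> h \<in> borel_measurable uniform01"
  unfolding uniform01_def by (rule measurable_restrict_space1) simp

lemma measure_uniform01: "S \<in> sets uniform01 \<Longrightarrow> measure uniform01 S = measure lborel S"
  unfolding uniform01_def by (intro measure_restrict_space) (auto simp: sets_restrict_space_iff)

lemma prob_space_uniform01: "prob_space uniform01"
proof
  show "emeasure uniform01 (space uniform01) = 1"
    by (simp add: uniform01_def emeasure_restrict_space space_restrict_space)
qed

lemma measurable_ident_uniform01 [measurable]: "(\<lambda>x. x) \<in> borel_measurable uniform01"
  by (rule borel_measurable_uniform01) simp

lemma integral_uniform01_below:
  assumes "0 \<le> u" "u \<le> 1"
  shows "(\<integral>t. (if t < u then 1 else 0) \<partial>uniform01) = u"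
proof -
  have "(\<integral>t. (if t < u then 1 else 0) \<partial>uniform01) = (\<integral>t. indicator {0..<u} t \<partial>uniform01)"
    by (intro Bochner_Integration.integral_cong) (auto simp: indicator_def)
  also have "\<dots> = measure uniform01 {0..<u}"
    using assms by (simp add: Int_absorb2 atLeastLessThan_subseteq_atLeastAtMost_iff)
  also have "\<dots> = u"
    using assms by (simp add: measure_uniform01 sets_uniform01 atLeastLessThan_subseteq_atLeastAtMost_iff)
  finally show ?thesis .
qed

lemma measure_uniform01_cell:
  assumes N: "0 < N"
  shows "measure uniform01 {y \<in> {0..1}. \<lfloor>real N * y\<rfloor> = k} \<le> 1 / real N"
proof -
  let ?J = "{real_of_int k / N ..< (real_of_int k + 1) / N}"
  have cell: "{y \<in> {0..1}. \<lfloor>real N * y\<rfloor> = k} = {0..1} \<inter> ?J"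
    using N by (auto simp: floor_eq_iff field_simps)
  have "measure uniform01 {y \<in> {0..1}. \<lfloor>real N * y\<rfloor> = k} = measure lborel ({0..1} \<inter> ?J)"
    unfolding cell by (rule measure_uniform01) (auto simp: sets_uniform01)
  also have "\<dots> \<le> measure lborel ?J"
    using N by (intro measure_mono_fmeasurable)
      (auto simp: fmeasurable_def divide_right_mono less_top[symmetric])
  also have "\<dots> = 1 / N"
    using N by (simp add: divide_right_mono add_divide_distrib)
  finally show ?thesis .
qed

text \<open>Local density speaks of sets, while the clique induction needs weights; a random set with
\<open>P(x \<in> S) = f(x)\<close> passes from one to the other. Cut \<open>[0,1]\<close> into cells of
length \<open>1/N\<close>, draw independent uniform thresholds \<open>t\<^sub>i\<close>, one per cell, and let
\<open>S\<close> consist of the points \<open>x\<close> whose cell has a threshold below \<open>f(x)\<close>. Points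
of different cells lie in \<open>S\<close> independently, so averaging the density inequality of
\<open>S\<close> over the thresholds yields the one for \<open>f\<close>, up to an error carried by the
pairs in a common cell. These have measure at most \<open>1/N\<close>, and \<open>N\<close> is arbitrary.\<close>

lemma weighted_density:
  assumes K: "symmetric_kernel uniform01 K" and \<rho>: "0 \<le> \<rho>" "\<rho> \<le> 1"
    and dense: "\<And>S. S \<in> sets uniform01 \<Longrightarrow> \<rho> * (measure uniform01 S)\<^sup>2
      \<le> (\<integral>z. indicator S (fst z) * indicator S (snd z) * K (fst z) (snd z) \<partial>(uniform01 \<Otimes>\<^sub>M uniform01))"
    and f_meas [measurable]: "f \<in> borel_measurable uniform01" and f: "\<And>x. 0 \<le> f x" "\<And>x. f x \<le> 1"
  shows "\<rho> * (\<integral>x. f x \<partial>uniform01)\<^sup>2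
    \<le> (\<integral>x. f x * (\<integral>y. f y * K x y \<partial>uniform01) \<partial>uniform01)"
proof -
  interpret symmetric_kernel uniform01 K by fact
  let ?Q = "uniform01 \<Otimes>\<^sub>M uniform01"
  have K_meas [measurable]: "(\<lambda>z. K (fst z) (snd z)) \<in> borel_measurable ?Q"
    using kernel_measurable by (simp add: case_prod_beta')
  \<comment> \<open>The claim says that \<open>K - \<rho>\<close> has a nonnegative integral against \<open>f(x) f(y)\<close>; being linear in the latter, it survives averaging over random sets.\<close>
  define D where "D z = K (fst z) (snd z) - \<rho>" for z
  have D_meas [measurable]: "D \<in> borel_measurable ?Q"
    unfolding D_def by measurable
  have D: "\<bar>D z\<bar> \<le> 1" for z
    using kernel_nonneg[of "fst z" "snd z"] kernel_le_1[of "fst z" "snd z"] \<rho> by (auto simp: D_def)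
  define F where "F z = f (fst z) * f (snd z)" for z
  have F_meas [measurable]: "F \<in> borel_measurable ?Q"
    unfolding F_def by measurable
  have F: "0 \<le> F z" "F z \<le> 1" for z
    using f by (auto simp: F_def intro: mult_le_one)
  have unit_D_int: "integrable ?Q (\<lambda>z. h z * D z)"
    if [measurable]: "h \<in> borel_measurable ?Q" and h: "\<And>z. \<bar>h z\<bar> \<le> 1" for h
    using D h by (intro MM.integrable_const_bound[of _ 1]) (auto simp: abs_mult intro!: mult_le_one)
  have unit_int: "integrable ?Q h"
    if "h \<in> borel_measurable ?Q" and h: "\<And>z. \<bar>h z\<bar> \<le> 1" for h :: "real \<times> real \<Rightarrow> real"
    using that by (intro MM.integrable_const_bound[of _ 1]) auto
  have split_D: "(\<integral>z. g (fst z) * g (snd z) * D z \<partial>?Q)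
      = (\<integral>z. g (fst z) * g (snd z) * K (fst z) (snd z) \<partial>?Q) - \<rho> * (\<integral>x. g x \<partial>uniform01)\<^sup>2"
    if [measurable]: "g \<in> borel_measurable uniform01" and g: "\<And>x. 0 \<le> g x" "\<And>x. g x \<le> 1" for g
  proof -
    have "integrable ?Q (\<lambda>z. g (fst z) * g (snd z) * K (fst z) (snd z))"
      using g kernel_nonneg kernel_le_1 by (intro unit_int) (auto simp: abs_mult intro!: mult_le_one)
    moreover have "integrable ?Q (\<lambda>z. g (fst z) * g (snd z))"
      using g by (intro unit_int) (auto simp: abs_mult intro!: mult_le_one)
    ultimately show ?thesis
      using integral_pair_times[of g g] g
      by (simp add: D_def right_diff_distrib power2_eq_square mult.commute[of _ \<rho>])
  qed
  have approx: "0 \<le> (\<integral>z. F z * D z \<partial>?Q) + 1 / real N" if N: "0 < N" for N :: nat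
  proof -
    \<comment> \<open>The cell of \<open>x\<close> is \<open>\<lfloor>N x\<rfloor>\<close>; the point \<open>1\<close> alone occupies cell \<open>N\<close>.\<close>
    define I where "I = {0..int N}"
    let ?P = "Pi\<^sub>M I (\<lambda>_. uniform01)"
    interpret P: prob_space ?P by (rule prob_space_cube)
    interpret PQ: pair_prob_space ?P ?Q ..
    \<comment> \<open>Writing the threshold of the cell of \<open>x\<close> as a finite sum makes its joint measurability in \<open>t\<close> and \<open>x\<close> evident.\<close>
    define thr where "thr t x = (\<Sum>i\<in>I. if \<lfloor>real N * x\<rfloor> = i then t i else 0)" for t :: "int \<Rightarrow> real" and x :: real
    define \<xi> where "\<xi> t x = (if thr t x < f x then 1 else 0 :: real)" for t x
    \<comment> \<open>The probability that both coordinates of \<open>z\<close> lie in the random set.\<close>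
    define E where "E z = (\<integral>t. \<xi> t (fst z) * \<xi> t (snd z) \<partial>?P)" for z
    define R where "R = {z \<in> space ?Q. \<lfloor>real N * fst z\<rfloor> = \<lfloor>real N * snd z\<rfloor>}"
    have \<xi>: "0 \<le> \<xi> t x" "\<xi> t x \<le> 1" for t x
      by (auto simp: \<xi>_def)
    have cell: "\<lfloor>real N * x\<rfloor> \<in> I" if "x \<in> {0..1}" for x
    proof -
      have "real N * x \<le> real N * 1"
        using that by (intro mult_left_mono) auto
      then have "\<lfloor>real N * x\<rfloor> \<le> int N"
        by linarith
      then show ?thesis
        using that by (simp add: I_def)
    qed
    have thr: "thr t x = t \<lfloor>real N * x\<rfloor>" if "x \<in> {0..1}" for t x
      using cell[OF that] by (simp add: thr_def I_def sum.delta)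
    have thr_meas: "(\<lambda>(t, x). thr t x) \<in> borel_measurable (?P \<Otimes>\<^sub>M uniform01)"
    proof -
      have "(\<lambda>p. fst p i) \<in> borel_measurable (?P \<Otimes>\<^sub>M uniform01)" if "i \<in> I" for i
      proof -
        have "(\<lambda>t. t i) \<in> borel_measurable ?P"
          using measurable_component_singleton[OF that, of "\<lambda>_. uniform01"]
          by (rule measurable_compose) (rule measurable_ident_uniform01)
        then show ?thesis
          by (rule measurable_compose[OF measurable_fst])
      qed
      moreover have "Measurable.pred (?P \<Otimes>\<^sub>M uniform01) (\<lambda>p. \<lfloor>real N * snd p\<rfloor> = i)" for i
      proof -
        have "Measurable.pred borel (\<lambda>x. \<lfloor>real N * x\<rfloor> = i)"
          by measurable
        then have "Measurable.pred uniform01 (\<lambda>x. \<lfloor>real N * x\<rfloor> = i)"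
          unfolding uniform01_def by (intro measurable_restrict_space1) simp
        then show ?thesis
          by (rule measurable_compose[OF measurable_snd])
      qed
      ultimately show ?thesis
        unfolding thr_def case_prod_beta' by (intro borel_measurable_sum measurable_If) auto
    qed
    have \<xi>_meas [measurable]: "(\<lambda>(t, x). \<xi> t x) \<in> borel_measurable (?P \<Otimes>\<^sub>M uniform01)"
      unfolding \<xi>_def using thr_meas by measurable
    have \<xi>\<xi>_meas [measurable]:
      "(\<lambda>(t, z). \<xi> t (fst z) * \<xi> t (snd z)) \<in> borel_measurable (?P \<Otimes>\<^sub>M ?Q)"
    proof -
      have "(\<lambda>p. (\<lambda>(t, x). \<xi> t x) (fst p, fst (snd p))) \<in> borel_measurable (?P \<Otimes>\<^sub>M ?Q)"
        by (rule measurable_compose[OF _ \<xi>_meas]) measurable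
      moreover have "(\<lambda>p. (\<lambda>(t, x). \<xi> t x) (fst p, snd (snd p))) \<in> borel_measurable (?P \<Otimes>\<^sub>M ?Q)"
        by (rule measurable_compose[OF _ \<xi>_meas]) measurable
      ultimately show ?thesis
        by (simp add: case_prod_beta')
    qed
    have R [measurable]: "R \<in> sets ?Q"
    proof -
      have "(\<lambda>x. \<lfloor>real N * x\<rfloor>) \<in> borel \<rightarrow>\<^sub>M count_space UNIV"
        by measurable
      then have cell_meas: "(\<lambda>x. \<lfloor>real N * x\<rfloor>) \<in> uniform01 \<rightarrow>\<^sub>M count_space UNIV"
        unfolding uniform01_def by (intro measurable_restrict_space1) simp
      have [measurable]: "(\<lambda>z. \<lfloor>real N * fst z\<rfloor>) \<in> ?Q \<rightarrow>\<^sub>M count_space UNIV"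
        "(\<lambda>z. \<lfloor>real N * snd z\<rfloor>) \<in> ?Q \<rightarrow>\<^sub>M count_space UNIV"
        using measurable_compose[OF measurable_fst cell_meas] measurable_compose[OF measurable_snd cell_meas]
        by simp_all
      show ?thesis
        unfolding R_def by measurable
    qed
    have R_int: "integrable ?Q (indicator R :: _ \<Rightarrow> real)"
      by (intro unit_int) (auto simp: indicator_def)
    have R_small: "measure ?Q R \<le> 1 / real N"
    proof -
      have "measure ?Q R = (\<integral>z. indicator R z \<partial>?Q)"
        using R by simp
      also have "\<dots> = (\<integral>x. (\<integral>y. indicator R (x, y) \<partial>uniform01) \<partial>uniform01)"
        by (rule MM.integral_fst'[OF R_int, symmetric])
      also have "\<dots> \<le> 1 / real N"
      proof (rule integral_le_const)
        show "integrable uniform01 (\<lambda>x. \<integral>y. (indicator R (x, y) :: real) \<partial>uniform01)"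
          by (rule MM.integrable_fst'[OF R_int])
        show "AE x in uniform01. (\<integral>y. indicator R (x, y) \<partial>uniform01) \<le> 1 / real N"
        proof (rule AE_I2)
          fix x assume x: "x \<in> space uniform01"
          let ?J = "{y \<in> {0..1}. \<lfloor>real N * y\<rfloor> = \<lfloor>real N * x\<rfloor>}"
          have "(\<integral>y. indicator R (x, y) \<partial>uniform01) = (\<integral>y. indicator ?J y \<partial>uniform01)"
            using x by (intro Bochner_Integration.integral_cong)
              (auto simp: R_def indicator_def space_pair_measure)
          also have "\<dots> = measure uniform01 (?J \<inter> space uniform01)"
            by (rule Bochner_Integration.integral_indicator)
          also have "?J \<inter> space uniform01 = ?J"
            by auto
          finally show "(\<integral>y. indicator R (x, y) \<partial>uniform01) \<le> 1 / real N"
            using measure_uniform01_cell[OF N, of "\<lfloor>real N * x\<rfloor>"] by simp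
        qed
      qed
      finally show ?thesis .
    qed
    have random_set: "0 \<le> (\<integral>z. \<xi> t (fst z) * \<xi> t (snd z) * D z \<partial>?Q)" if t: "t \<in> space ?P" for t
    proof -
      have \<xi>t [measurable]: "\<xi> t \<in> borel_measurable uniform01"
        using measurable_Pair2[OF \<xi>_meas t] by simp
      define S where "S = {x \<in> space uniform01. \<xi> t x = 1}"
      have S: "S \<in> sets uniform01"
        unfolding S_def by measurable
      have ind: "\<xi> t x = indicator S x" if "x \<in> space uniform01" for x
        using that by (auto simp: S_def \<xi>_def)
      have "(\<integral>z. \<xi> t (fst z) * \<xi> t (snd z) * K (fst z) (snd z) \<partial>?Q)
          = (\<integral>z. indicator S (fst z) * indicator S (snd z) * K (fst z) (snd z) \<partial>?Q)"
        by (intro Bochner_Integration.integral_cong) (auto simp: space_pair_measure ind)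
      moreover have "(\<integral>x. \<xi> t x \<partial>uniform01) = measure uniform01 S"
      proof -
        have "(\<integral>x. \<xi> t x \<partial>uniform01) = (\<integral>x. indicator S x \<partial>uniform01)"
          by (intro Bochner_Integration.integral_cong refl ind)
        then show ?thesis
          using S sets.sets_into_space[OF S] by (simp add: Int_absorb2)
      qed
      ultimately show ?thesis
        using dense[OF S] split_D[OF \<xi>t \<xi>] by simp
    qed
    have "0 \<le> (\<integral>t. (\<integral>z. \<xi> t (fst z) * \<xi> t (snd z) * D z \<partial>?Q) \<partial>?P)"
      by (rule integral_nonneg_AE[OF AE_I2[OF random_set]])
    also have "\<dots> = (\<integral>z. (\<integral>t. \<xi> t (fst z) * \<xi> t (snd z) * D z \<partial>?P) \<partial>?Q)"
    proof (rule PQ.Fubini_integral[symmetric])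
      have "(\<lambda>(t, z). \<xi> t (fst z) * \<xi> t (snd z) * D z) \<in> borel_measurable (?P \<Otimes>\<^sub>M ?Q)"
        using \<xi>\<xi>_meas unfolding case_prod_beta' by measurable
      then show "integrable (?P \<Otimes>\<^sub>M ?Q) (\<lambda>(t, z). \<xi> t (fst z) * \<xi> t (snd z) * D z)"
        using \<xi> D by (intro PQ.integrable_const_bound[of _ 1] AE_I2)
          (auto simp: case_prod_beta' abs_mult intro!: mult_le_one)
    qed
    also have "\<dots> = (\<integral>z. E z * D z \<partial>?Q)"
      by (simp add: E_def)
    \<comment> \<open>Off \<open>R\<close> independence gives \<open>E z = F z\<close>; on \<open>R\<close> the bounds \<open>\<bar>E z - F z\<bar> \<le> 1\<close> and \<open>\<bar>D z\<bar> \<le> 1\<close> are enough.\<close>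
    also have "\<dots> \<le> (\<integral>z. F z * D z + indicator R z \<partial>?Q)"
    proof (rule integral_mono)
      have E: "0 \<le> E z" "E z \<le> 1" if "z \<in> space ?Q" for z
      proof -
        have [measurable]: "(\<lambda>t. \<xi> t (fst z) * \<xi> t (snd z)) \<in> borel_measurable ?P"
          using measurable_Pair1[OF \<xi>\<xi>_meas that] by simp
        have "integrable ?P (\<lambda>t. \<xi> t (fst z) * \<xi> t (snd z))"
          using \<xi> by (intro P.integrable_const_bound[of _ 1]) (auto intro!: mult_le_one)
        then show "0 \<le> E z" "E z \<le> 1"
          unfolding E_def using \<xi> by (auto intro!: P.integral_le_const integral_nonneg_AE mult_le_one)
      qed
      have E_meas [measurable]: "E \<in> borel_measurable ?Q"
      proof -
        have "(\<lambda>(z, t). \<xi> t (fst z) * \<xi> t (snd z)) \<in> borel_measurable (?Q \<Otimes>\<^sub>M ?P)"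
          using measurable_compose[OF measurable_pair_swap' \<xi>\<xi>_meas] by (simp add: case_prod_beta)
        then show ?thesis
          unfolding E_def[abs_def] by (rule P.borel_measurable_lebesgue_integral)
      qed
      show "integrable ?Q (\<lambda>z. E z * D z)"
        using E D by (intro MM.integrable_const_bound[of _ 1]) (auto simp: abs_mult intro!: AE_I2 mult_le_one)
      show "integrable ?Q (\<lambda>z. F z * D z + indicator R z)"
        using unit_D_int[OF F_meas] F R_int by (intro Bochner_Integration.integrable_add) auto
      fix z assume z: "z \<in> space ?Q"
      show "E z * D z \<le> F z * D z + indicator R z"
      proof (cases "\<lfloor>real N * fst z\<rfloor> = \<lfloor>real N * snd z\<rfloor>")
        case True
        have "\<bar>E z - F z\<bar> * \<bar>D z\<bar> \<le> 1"
          using E[OF z] F[of z] D by (intro mult_le_one) auto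
        then have "(E z - F z) * D z \<le> 1"
          by (metis abs_ge_self abs_mult order_trans)
        then show ?thesis
          using True z by (simp add: left_diff_distrib R_def)
      next
        case False
        obtain x y where xy: "z = (x, y)" "x \<in> {0..1}" "y \<in> {0..1}"
          using z by (auto simp: space_pair_measure)
        define A B where "A s = (if s < f x then 1 else 0 :: real)"
          and "B s = (if s < f y then 1 else 0 :: real)" for s
        have [measurable]: "A \<in> borel_measurable uniform01" "B \<in> borel_measurable uniform01"
          unfolding A_def B_def by measurable
        have "E z = (\<integral>t. A (t \<lfloor>real N * x\<rfloor>) * B (t \<lfloor>real N * y\<rfloor>) \<partial>?P)"
          using xy by (simp add: E_def \<xi>_def thr A_def B_def)
        also have "\<dots> = (\<integral>w. A (fst w) * B (snd w) \<partial>distr ?P ?Q (\<lambda>t. (t \<lfloor>real N * x\<rfloor>, t \<lfloor>real N * y\<rfloor>)))"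
          using cell[OF xy(2)] cell[OF xy(3)]
          by (subst integral_distr)
            (auto intro!: measurable_Pair measurable_component_singleton)
        also have "distr ?P ?Q (\<lambda>t. (t \<lfloor>real N * x\<rfloor>, t \<lfloor>real N * y\<rfloor>)) = ?Q"
          using cell[OF xy(2)] cell[OF xy(3)] False xy by (intro distr_cube_pair) auto
        also have "(\<integral>w. A (fst w) * B (snd w) \<partial>?Q) = F z"
          using f xy by (subst integral_pair_times) (auto simp: A_def[abs_def] B_def[abs_def] integral_uniform01_below F_def)
        finally show ?thesis
          by simp
      qed
    qed
    also have "\<dots> \<le> (\<integral>z. F z * D z \<partial>?Q) + 1 / real N"
      using unit_D_int[OF F_meas] F R_int R_small by simp
    finally show ?thesis .
  qed
  have "0 \<le> (\<integral>z. F z * D z \<partial>?Q)"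
  proof (rule ccontr)
    assume neg: "\<not> 0 \<le> (\<integral>z. F z * D z \<partial>?Q)"
    then obtain N where "0 < N" "inverse (real N) < - (\<integral>z. F z * D z \<partial>?Q)"
      using ex_inverse_of_nat_less[of "- (\<integral>z. F z * D z \<partial>?Q)"] by auto
    then show False
      using approx[of N] by (simp add: inverse_eq_divide)
  qed
  then have "\<rho> * (\<integral>x. f x \<partial>uniform01)\<^sup>2 \<le> (\<integral>z. f (fst z) * f (snd z) * K (fst z) (snd z) \<partial>?Q)"
    using split_D[OF f_meas f] by (simp add: F_def)
  also have "\<dots> = (\<integral>x. f x * (\<integral>y. f y * K x y \<partial>uniform01) \<partial>uniform01)"
  proof -
    have "integrable ?Q (\<lambda>z. f (fst z) * f (snd z) * K (fst z) (snd z))"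
      using f kernel_nonneg kernel_le_1 by (intro unit_int) (auto simp: abs_mult intro!: mult_le_one)
    then show ?thesis
      by (subst MM.integral_fst'[symmetric]) (simp_all add: mult.assoc)
  qed
  finally show ?thesis .
qed

section \<open>Borel versions of graphons\<close>

text \<open>Integrals of functions that are not measurable are \<open>0\<close> by convention, so replacing a
Lebesgue measurable integrand by a Borel one must also show that the former is measurable
for the completed measure.\<close>

lemma borel_measurable_completion_AE_eq:
  fixes f g :: "'b \<Rightarrow> real"
  assumes f: "f \<in> borel_measurable (completion M)" and eq: "AE x in M. f x = g x"
  shows "g \<in> borel_measurable (completion M)"
proof (rule measurableI)
  fix A :: "real set" assume A: "A \<in> sets borel"
  show "g -` A \<inter> space (completion M) \<in> sets (completion M)"
  proof (rule completion.in_sets_AE)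
    show "f -` A \<inter> space (completion M) \<in> sets (completion M)"
      using f A by (rule measurable_sets)
    show "AE x in completion M. (x \<in> f -` A \<inter> space (completion M)) = (x \<in> g -` A \<inter> space (completion M))"
      using AE_completion[OF eq] by eventually_elim auto
  qed auto
qed auto

lemma integral_completion_AE_eq:
  fixes f g :: "'b \<Rightarrow> real"
  assumes f: "f \<in> borel_measurable M" and eq: "AE x in M. f x = g x"
  shows "(\<integral>x. g x \<partial>completion M) = (\<integral>x. f x \<partial>M)"
proof -
  have "(\<integral>x. g x \<partial>completion M) = (\<integral>x. f x \<partial>completion M)"
  proof (rule integral_cong_AE)
    show "g \<in> borel_measurable (completion M)"
      using borel_measurable_completion_AE_eq[OF measurable_completion[OF f] eq] .
    show "AE x in completion M. g x = f x"
      using AE_completion[OF eq] by eventually_elim simp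
  qed (rule measurable_completion[OF f])
  then show ?thesis
    by (simp add: integral_completion f)
qed

lemma uniform01_pair: "uniform01 \<Otimes>\<^sub>M uniform01 = restrict_space lborel ({0..1} \<times> {0..1})"
proof (rule pair_measure_eqI)
  let ?X = "{0..1} \<times> {0..1} :: (real \<times> real) set"
  let ?R = "restrict_space lborel ?X"
  have X: "?X \<in> sets borel"
    by (intro borel_closed closed_Times) auto
  interpret prob_space uniform01 by (rule prob_space_uniform01)
  show "sigma_finite_measure uniform01" "sigma_finite_measure uniform01"
    by (rule sigma_finite_measure_axioms)+
  show "sets (uniform01 \<Otimes>\<^sub>M uniform01) = sets ?R"
  proof (intro equalityI subsetI)
    fix A assume A: "A \<in> sets (uniform01 \<Otimes>\<^sub>M uniform01)"
    have "fst \<in> borel_measurable (borel :: (real \<times> real) measure)"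
      "snd \<in> borel_measurable (borel :: (real \<times> real) measure)"
      by (simp_all flip: borel_prod)
    then have "fst \<in> borel_measurable ?R" "snd \<in> borel_measurable ?R"
      by (simp_all add: measurable_restrict_space1)
    then have "fst \<in> ?R \<rightarrow>\<^sub>M uniform01" "snd \<in> ?R \<rightarrow>\<^sub>M uniform01"
      unfolding uniform01_def
      by (intro measurable_restrict_space2; auto simp: space_restrict_space)+
    then have "(\<lambda>z. (fst z, snd z)) \<in> ?R \<rightarrow>\<^sub>M uniform01 \<Otimes>\<^sub>M uniform01"
      by (rule measurable_Pair)
    from measurable_sets[OF this A] have "A \<inter> space ?R \<in> sets ?R"
      by (simp add: vimage_def Int_def)
    moreover have "A \<subseteq> space ?R"
      using sets.sets_into_space[OF A] by (simp add: space_pair_measure space_restrict_space)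
    ultimately show "A \<in> sets ?R"
      by (simp add: Int_absorb2)
  next
    fix A assume "A \<in> sets ?R"
    then have A: "A \<in> sets borel" "A \<subseteq> ?X"
      using X by (auto simp: sets_restrict_space_iff)
    have "(\<lambda>z. (fst z, snd z)) \<in> uniform01 \<Otimes>\<^sub>M uniform01 \<rightarrow>\<^sub>M borel \<Otimes>\<^sub>M borel"
      by (intro measurable_Pair measurable_compose[OF measurable_fst measurable_ident_uniform01]
          measurable_compose[OF measurable_snd measurable_ident_uniform01])
    then have "(\<lambda>z. z) \<in> uniform01 \<Otimes>\<^sub>M uniform01 \<rightarrow>\<^sub>M borel"
      by (simp add: borel_prod)
    from measurable_sets[OF this A(1)] show "A \<in> sets (uniform01 \<Otimes>\<^sub>M uniform01)"
      using A(2) by (simp add: space_pair_measure Int_absorb2)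
  qed
  fix A B assume AB: "A \<in> sets uniform01" "B \<in> sets uniform01"
  then have AB': "A \<in> sets borel" "A \<subseteq> {0..1}" "B \<in> sets borel" "B \<subseteq> {0..1}"
    by (auto simp: sets_uniform01)
  have "emeasure uniform01 A * emeasure uniform01 B = emeasure lborel A * emeasure lborel B"
    using AB' by (simp add: uniform01_def emeasure_restrict_space)
  also have "\<dots> = emeasure (lborel \<Otimes>\<^sub>M lborel) (A \<times> B)"
    using AB' by (simp add: lborel.emeasure_pair_measure_Times)
  also have "\<dots> = emeasure ?R (A \<times> B)"
    using AB' X by (subst emeasure_restrict_space) (auto simp: lborel_prod)
  finally show "emeasure uniform01 A * emeasure uniform01 B = emeasure ?R (A \<times> B)" .
qed

lemma AE_uniform01_pair_iff:
  "(AE z in uniform01 \<Otimes>\<^sub>M uniform01. P z) \<longleftrightarrow> (AE z in lborel. z \<in> {0..1} \<times> {0..1} \<longrightarrow> P z)"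
proof -
  have "{0..1} \<times> {0..1} \<in> sets (borel :: (real \<times> real) measure)"
    by (intro borel_closed closed_Times) auto
  then show ?thesis
    unfolding uniform01_pair by (subst AE_restrict_space_iff) auto
qed

text \<open>Fubini on product spaces and induction on the number of vertices need Borel measurable
integrands. A Borel function that agrees almost everywhere with \<open>W\<close> need be neither
symmetric nor bounded; averaging it with its reflection and truncating to \<open>[0,1]\<close> repairs
this everywhere and changes it only on a null set, because reflection preserves the measure.\<close>

lemma graphon_borel_version:
  assumes W: "graphon W"
  obtains K where "symmetric_kernel uniform01 K"
    "AE z in uniform01 \<Otimes>\<^sub>M uniform01. W (fst z) (snd z) = K (fst z) (snd z)"
proof -
  let ?X = "{0..1} \<times> {0..1} :: (real \<times> real) set"
  let ?Q = "uniform01 \<Otimes>\<^sub>M uniform01"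
  interpret prob_space uniform01 by (rule prob_space_uniform01)
  interpret MM: pair_prob_space uniform01 uniform01 ..
  have X: "?X \<in> sets borel"
    by (intro borel_closed closed_Times) auto
  have "(\<lambda>z. if z \<in> ?X then (\<lambda>(x, y). W x y) z else 0) \<in> borel_measurable lebesgue"
    using W X by (intro borel_measurable_if_I) (auto simp: graphon_def)
  then obtain g where g: "g \<in> borel_measurable lborel"
    and "AE z in lborel. (if z \<in> ?X then (\<lambda>(x, y). W x y) z else 0) = g z"
    using completion_ex_borel_measurable_real by blast
  then have g_eq: "AE z in ?Q. W (fst z) (snd z) = g z"
    unfolding AE_uniform01_pair_iff
    by (elim eventually_mono) (auto split: if_splits prod.splits)
  have g_meas: "g \<in> borel_measurable ?Q"
    unfolding uniform01_pair using g by (rule measurable_restrict_space1)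
  have swap: "(\<lambda>(x, y). (y, x)) \<in> ?Q \<rightarrow>\<^sub>M ?Q"
    by (rule measurable_pair_swap')
  have "AE z in distr ?Q ?Q (\<lambda>(x, y). (y, x)). W (fst z) (snd z) = g z"
    by (subst MM.distr_pair_swap[symmetric]) (rule g_eq)
  from AE_distrD[OF swap this] have g_eq': "AE z in ?Q. W (snd z) (fst z) = g (snd z, fst z)"
    by (simp add: case_prod_beta')
  have g_meas': "(\<lambda>z. g (snd z, fst z)) \<in> borel_measurable ?Q"
    using measurable_compose[OF swap g_meas] by (simp add: case_prod_beta')
  define K where "K x y = max 0 (min 1 ((g (x, y) + g (y, x)) / 2))" for x y
  show ?thesis
  proof
    show "symmetric_kernel uniform01 K"
    proof
      show "case_prod K \<in> borel_measurable ?Q"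
        using g_meas g_meas' unfolding K_def case_prod_beta' by simp
    qed (auto simp: K_def add.commute)
    have "AE z in ?Q. z \<in> space ?Q"
      by (rule AE_space)
    with g_eq g_eq' show "AE z in ?Q. W (fst z) (snd z) = K (fst z) (snd z)"
    proof eventually_elim
      case (elim z)
      obtain x y where z: "z = (x, y)" "x \<in> {0..1}" "y \<in> {0..1}"
        using elim(3) by (auto simp: space_pair_measure)
      moreover have "W x y = W y x" "0 \<le> W x y" "W x y \<le> 1"
        using W z unfolding graphon_def by auto
      ultimately show ?case
        using elim by (simp add: K_def)
    qed
  qed
qed

lemma locally_dense_borel_version:
  assumes dense: "locally_dense \<rho> W" and K: "symmetric_kernel uniform01 K"
    and eq: "AE z in uniform01 \<Otimes>\<^sub>M uniform01. W (fst z) (snd z) = K (fst z) (snd z)"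
    and S: "S \<in> sets uniform01"
  shows "\<rho> * (measure uniform01 S)\<^sup>2
    \<le> (\<integral>z. indicator S (fst z) * indicator S (snd z) * K (fst z) (snd z) \<partial>(uniform01 \<Otimes>\<^sub>M uniform01))"
proof -
  let ?X = "{0..1} \<times> {0..1} :: (real \<times> real) set"
  let ?Q = "uniform01 \<Otimes>\<^sub>M uniform01"
  interpret symmetric_kernel uniform01 K by fact
  have X: "?X \<in> sets borel"
    by (intro borel_closed closed_Times) auto
  have S': "S \<in> sets borel" "S \<subseteq> {0..1}"
    using S by (auto simp: sets_uniform01)
  define h where "h z = indicator S (fst z) * indicator S (snd z) * K (fst z) (snd z)" for z
  have h_meas: "h \<in> borel_measurable ?Q"
    unfolding h_def using kernel_measurable S by (simp add: case_prod_beta')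
  have h_meas': "(\<lambda>z. indicator ?X z *\<^sub>R h z) \<in> borel_measurable lborel"
    using h_meas X unfolding uniform01_pair by (subst (asm) borel_measurable_restrict_space_iff) auto
  have "\<rho> * (measure uniform01 S)\<^sup>2 = \<rho> * (measure lebesgue S)\<^sup>2"
    using S S' by (simp add: measure_uniform01)
  also have "\<dots> \<le> (LINT z:S \<times> S|lebesgue. (case z of (x, y) \<Rightarrow> W x y))"
  proof -
    have "S \<in> sets lebesgue"
      using S'(1) by (simp add: sets_completionI_sets)
    then show ?thesis
      using dense S'(2) unfolding locally_dense_def by blast
  qed
  also have "\<dots> = (\<integral>z. indicator ?X z *\<^sub>R h z \<partial>lborel)"
    unfolding set_lebesgue_integral_def
  proof (rule integral_completion_AE_eq[OF h_meas'])
    show "AE z in lborel. indicator ?X z *\<^sub>R h z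
        = indicator (S \<times> S) z *\<^sub>R (case z of (x, y) \<Rightarrow> W x y)"
      using eq unfolding AE_uniform01_pair_iff
      by eventually_elim (use S'(2) in \<open>auto simp: h_def indicator_def\<close>)
  qed
  also have "\<dots> = (\<integral>z. h z \<partial>?Q)"
    unfolding uniform01_pair using X by (subst integral_restrict_space) auto
  finally show ?thesis
    by (simp add: h_def)
qed

text \<open>The kernels differ only on a null set of the square. Its preimage under each pair of distinct
coordinates is null because two coordinates are jointly uniform on the square, and there are
finitely many edges.\<close>

lemma hom_density_borel_version:
  assumes F: "loopless_multigraph F" and W: "graphon W" and K: "symmetric_kernel uniform01 K"
    and eq: "AE z in uniform01 \<Otimes>\<^sub>M uniform01. W (fst z) (snd z) = K (fst z) (snd z)"
  shows "hom_density F (pointwise_power W q)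
    = (\<integral>x. (\<Prod>e\<in>#edges F. edge_factor K x e powr q) \<partial>Pi\<^sub>M (verts F) (\<lambda>_. uniform01))"
proof -
  let ?P = "Pi\<^sub>M (verts F) (\<lambda>_. uniform01)"
  interpret symmetric_kernel uniform01 K by fact
  have edge: "e \<in> pairs (verts F)" if "e \<in># edges F" for e
    using F that by (auto simp: loopless_multigraph_def pairs_def)
  have "AE x in ?P. \<forall>e\<in>set_mset (edges F). edge_factor K x e powr q = edge_factor (pointwise_power W q) x e"
  proof (rule AE_finite_allI)
    fix e assume "e \<in># edges F"
    then obtain i j where ij: "i \<in> verts F" "j \<in> verts F" "i \<noteq> j" "e = {i, j}"
      using edge pairs_E by metis
    have "AE z in distr ?P (uniform01 \<Otimes>\<^sub>M uniform01) (\<lambda>x. (x i, x j)). W (fst z) (snd z) = K (fst z) (snd z)"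
      by (subst distr_cube_pair[OF ij(1-3)]) (rule eq)
    from AE_distrD[OF _ this] have "AE x in ?P. W (x i) (x j) = K (x i) (x j)"
      using ij by (simp add: measurable_Pair measurable_component_singleton)
    moreover have "AE x in ?P. x \<in> space ?P"
      by (rule AE_space)
    ultimately show "AE x in ?P. edge_factor K x e powr q = edge_factor (pointwise_power W q) x e"
    proof eventually_elim
      case (elim x)
      have "x i \<in> {0..1}" "x j \<in> {0..1}"
        using elim(2) ij by (auto simp: space_PiM PiE_iff simp del: atLeastAtMost_iff)
      then have "W (x i) (x j) = W (x j) (x i)"
        using W by (simp add: graphon_def)
      then show ?case
        using elim(1) by (simp add: ij edge_factor_kernel edge_factor_insert pointwise_power_def)
    qed
  qed simp
  then have prod_eq: "AE x in ?P. (\<Prod>e\<in>#edges F. edge_factor K x e powr q)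
      = (\<Prod>e\<in>#edges F. edge_factor (pointwise_power W q) x e)"
    by eventually_elim (intro arg_cong[where f = prod_mset] image_mset_cong, simp)
  have "(\<lambda>x. \<Prod>e\<in>#edges F. edge_factor K x e powr q) \<in> borel_measurable ?P"
    using edge by (rule prod_edge_factor_powr_measurable)
  from integral_completion_AE_eq[OF this prod_eq] show ?thesis
    by (simp add: hom_density_def unit_cube_def uniform01_def)
qed

section \<open>Powers of locally dense graphons\<close>

theorem theorem1p2:
  fixes F :: "'a multigraph" and q :: real
  assumes "loopless_multigraph F"
    and "num_edges F > 0"
    and "q \<ge> real (card (non_isolated_verts F) choose 2) / real (num_edges F)"
  shows "\<forall>\<rho>\<in>{0..1::real}. \<forall>W. graphon W \<and> locally_dense \<rho> W \<longrightarrow>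
           hom_density F (pointwise_power W q) \<ge> \<rho> powr (q * real (num_edges F))"
proof (intro ballI allI impI)
  fix \<rho> :: real and W
  assume \<rho>: "\<rho> \<in> {0..1}" and W: "graphon W \<and> locally_dense \<rho> W"
  obtain K where K: "symmetric_kernel uniform01 K"
    and eq: "AE z in uniform01 \<Otimes>\<^sub>M uniform01. W (fst z) (snd z) = K (fst z) (snd z)"
    using graphon_borel_version W by blast
  interpret symmetric_kernel uniform01 K by fact
  have "\<rho> powr (q * real (size (edges F)))
      \<le> (\<integral>x. (\<Prod>e\<in>#edges F. edge_factor K x e powr q) \<partial>Pi\<^sub>M (verts F) (\<lambda>_. uniform01))"
  proof (rule power_hom_density_lower_bound)
    show "\<rho> * (\<integral>x. f x \<partial>uniform01)\<^sup>2 \<le> (\<integral>x. f x * (\<integral>y. f y * K x y \<partial>uniform01) \<partial>uniform01)"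
      if "f \<in> borel_measurable uniform01" "\<And>x. 0 \<le> f x" "\<And>x. f x \<le> 1" for f
      using \<rho> that W by (intro weighted_density K locally_dense_borel_version[OF _ K eq]) auto
    show "finite (verts F)" "non_isolated_verts F \<subseteq> verts F"
      using assms(1) by (auto simp: loopless_multigraph_def non_isolated_verts_def)
    show "e \<in> pairs (non_isolated_verts F)" if "e \<in># edges F" for e
      using assms(1) that by (auto simp: loopless_multigraph_def non_isolated_verts_def pairs_def)
    show "edges F \<noteq> {#}"
      using assms(2) by (auto simp: num_edges_def)
  qed (use \<rho> assms(3) in \<open>auto simp: num_edges_def\<close>)
  then show "hom_density F (pointwise_power W q) \<ge> \<rho> powr (q * real (num_edges F))"
    using W by (simp add: hom_density_borel_version[OF assms(1) _ K eq] num_edges_def)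
qed

end
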